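(* (i) The inequalities (V) of the context are valid for the MILP of the context: for every instance (every POMDP with rewards $r_t$, every horizon $T\in\mathbb{Z}_+$ and every initial belief $b\in\mathcal{B}$) and every feasible solution $(\mu,\delta)$ of the MILP, there exist nonnegative numbers $(\mu^t_{s'a'soa})$ such that (V1), (V2), (V3) hold. (ii) There exists a solution of the linear relaxation of the MILP that does not satisfy (V): that is, there exist an instance and a feasible solution $(\mu,\delta)$ of the linear relaxation of the corresponding MILP for which there are no nonnegative numbers $(\mu^t_{s'a'soa})$ satisfying (V1), (V2), (V3).
   Context: **POMDP.** $\mathcal{S},\mathcal{O},\mathcal{A}$ are finite nonempty sets (states, observations, actions); $p(o|s)$ is a probability distribution on $\mathcal{O}$ for each $s$; $p(s'|s,a)$ is a probability distribution on $\mathcal{S}$ for each $(s,a)$; $r_t:\mathcal{S}\times\mathcal{A}\to\mathbb{R}$, $t\in\{0,\dots,T\}$, are reward functions; $\mathcal{B}$ is the set of probability distributions on $\mathcal{S}$ and $b\in\mathcal{B}$ is the initial belief. Write $[T]=\{0,\dots,T\}$. $\Delta_{\mathrm{ml}}^T$ is the set of $\delta=(\delta^t_{a|o})_{t\in[T],a\in\mathcal{A},o\in\mathcal{O}}$ with $\delta^t_{a|o}\ge 0$ and $\sum_a\delta^t_{a|o}=1$ for all $o,t$; $\Delta_{\mathrm{ml}}^{T,\mathrm{d}}$ is the subset of those with all entries in $\{0,1\}$. **MILP.** Variables $\mu=\big((\mu_s^t)_{t\in[T+1]},(\mu_{soa}^t)_{t\in[T]},(\mu_{sa}^t)_{t\in[T]}\big)$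 and $\delta$. Maximize $\sum_{t=0}^T\sum_{s,a}r_t(s,a)\mu_{sa}^t$ subject to: - $\delta^0_{a|o}=\delta^0_{a|o'}$ for all $o,o',a$; - $\mu_s^0=b(s)$ for all $s$; - $\mu_s^t=\sum_a\mu_{sa}^t$ for all $s$, $t\in[T]$; - $\mu_{sa}^t=\sum_o\mu_{soa}^t$ for all $s,a$, $t\in[T]$; - $\mu_s^{t+1}=\sum_{s',a'}p(s|s',a')\mu_{s'a'}^t$ for all $s$, $t\in[T]$; - (McCormick) $\mu_{soa}^t\le p(o|s)\mu_s^t$, $\ \mu_{soa}^t\le\delta^t_{a|o}$, $\ \mu_{soa}^t\ge p(o|s)\mu_s^t+\delta^t_{a|o}-1$ for all $s,o,a$, $t\in[T]$; - $\delta\in\Delta_{\mathrm{ml}}^{T,\mathrm{d}}$, $\mu\ge0$. Its **linear relaxation** is obtained by replacing $\delta\in\Delta_{\mathrm{ml}}^{T,\mathrm{d}}$ by $\delta\in\Delta_{\mathrm{ml}}^{T}$. **Inequalities (V).** With additional nonnegative variables $\mu_{s'a'soa}^t$ ($s',s\in\mathcal{S}$, $a',a\in\mathcal{A}$, $o\in\mathcal{O}$, $t\in\{1,\dots,T\}$), for all $t\in\{1,\dots,T\}$: - (V1) $\sum_{s',a'}\mu_{s'a'soa}^t=\mu_{soa}^t$ for all $s,o,a$; - (V2) $\sum_{a}\mu_{s'a'soa}^t=p(o|s)\,p(s|s',a')\,\mu_{s'a'}^{t-1}$ for all $s',a',s,o$; - (V3) $\mu_{s'a'soa}^t=p(s|s',a',o)\sum_{\bar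 s\in\mathcal{S}}\mu_{s'a'\bar s oa}^t$ for all $s',a',s,o,a$, where $p(s|s',a',o)=\dfrac{p(o|s)p(s|s',a')}{\sum_{\bar s}p(o|\bar s)p(\bar s|s',a')}$ is the conditional probability of $S_t=s$ given $S_{t-1}=s',A_{t-1}=a',O_t=o$ (set to $0$ when the denominator vanishes). *)

theory Defs
  imports Complex_Main
begin

definition prob_dist_on :: "'x set \<Rightarrow> ('x \<Rightarrow> real) \<Rightarrow> bool" where
  "prob_dist_on X f \<longleftrightarrow> (\<forall>x\<in>X. f x \<ge> 0) \<and> (\<Sum>x\<in>X. f x) = 1"

text \<open>
  The spaces are carrier sets rather than types, so that one can quantify existentially over
  instances.  Conditional probabilities take their conditions first: \<open>obs_prob P s ob\<close> is
  $p(o|s)$ and \<open>trans_prob P s a s'\<close> is $p(s'|s,a)$.  Functions are only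
  constrained, and only used, on the carriers and on the relevant time indices.
\<close>

record ('s, 'o, 'a) pomdp =
  states :: "'s set"
  observations :: "'o set"
  actions :: "'a set"
  obs_prob :: "'s \<Rightarrow> 'o \<Rightarrow> real"
  trans_prob :: "'s \<Rightarrow> 'a \<Rightarrow> 's \<Rightarrow> real"
  reward :: "nat \<Rightarrow> 's \<Rightarrow> 'a \<Rightarrow> real"
  horizon :: nat
  init_belief :: "'s \<Rightarrow> real"

definition is_pomdp :: "('s, 'o, 'a) pomdp \<Rightarrow> bool" where
  "is_pomdp P \<longleftrightarrow>
     finite (states P) \<and> states P \<noteq> {} \<and>
     finite (observations P) \<and> observations P \<noteq> {} \<and>
     finite (actions P) \<and> actions P \<noteq> {} \<and>
     (\<forall>s\<in>states P. prob_dist_on (observations P) (obs_prob P s)) \<and>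
     (\<forall>s\<in>states P. \<forall>a\<in>actions P. prob_dist_on (states P) (trans_prob P s a)) \<and>
     prob_dist_on (states P) (init_belief P)"

text \<open>
  Policies: \<open>\<delta> t a ob\<close> is $\delta^t_{a|o}$.
\<close>

definition memoryless_policies :: "('s, 'o, 'a) pomdp \<Rightarrow> (nat \<Rightarrow> 'a \<Rightarrow> 'o \<Rightarrow> real) set" where
  "memoryless_policies P =
     {\<delta>. \<forall>t\<le>horizon P. \<forall>ob\<in>observations P. prob_dist_on (actions P) (\<lambda>a. \<delta> t a ob)}"

definition det_memoryless_policies :: "('s, 'o, 'a) pomdp \<Rightarrow> (nat \<Rightarrow> 'a \<Rightarrow> 'o \<Rightarrow> real) set" where
  "det_memoryless_policies P =
     {\<delta> \<in> memoryless_policies P.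
        \<forall>t\<le>horizon P. \<forall>a\<in>actions P. \<forall>ob\<in>observations P. \<delta> t a ob \<in> {0, 1}}"

record ('s, 'o, 'a) moments =
  mu_s :: "nat \<Rightarrow> 's \<Rightarrow> real"
  mu_soa :: "nat \<Rightarrow> 's \<Rightarrow> 'o \<Rightarrow> 'a \<Rightarrow> real"
  mu_sa :: "nat \<Rightarrow> 's \<Rightarrow> 'a \<Rightarrow> real"

definition moments_nonneg :: "('s, 'o, 'a) pomdp \<Rightarrow> ('s, 'o, 'a) moments \<Rightarrow> bool" where
  "moments_nonneg P \<mu> \<longleftrightarrow>
     (\<forall>t\<le>horizon P + 1. \<forall>s\<in>states P. mu_s \<mu> t s \<ge> 0) \<and>
     (\<forall>t\<le>horizon P. \<forall>s\<in>states P. \<forall>ob\<in>observations P. \<forall>a\<in>actions P. mu_soa \<mu> t s ob a \<ge> 0) \<and>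
     (\<forall>t\<le>horizon P. \<forall>s\<in>states P. \<forall>a\<in>actions P. mu_sa \<mu> t s a \<ge> 0)"

definition mccormick ::
  "('s, 'o, 'a) pomdp \<Rightarrow> ('s, 'o, 'a) moments \<Rightarrow> (nat \<Rightarrow> 'a \<Rightarrow> 'o \<Rightarrow> real) \<Rightarrow> bool" where
  "mccormick P \<mu> \<delta> \<longleftrightarrow>
     (\<forall>t\<le>horizon P. \<forall>s\<in>states P. \<forall>ob\<in>observations P. \<forall>a\<in>actions P.
        mu_soa \<mu> t s ob a \<le> obs_prob P s ob * mu_s \<mu> t s \<and>
        mu_soa \<mu> t s ob a \<le> \<delta> t a ob \<and>
        mu_soa \<mu> t s ob a \<ge> obs_prob P s ob * mu_s \<mu> t s + \<delta> t a ob - 1)"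

definition linear_constraints ::
  "('s, 'o, 'a) pomdp \<Rightarrow> ('s, 'o, 'a) moments \<Rightarrow> (nat \<Rightarrow> 'a \<Rightarrow> 'o \<Rightarrow> real) \<Rightarrow> bool" where
  "linear_constraints P \<mu> \<delta> \<longleftrightarrow>
     (\<forall>ob\<in>observations P. \<forall>ob'\<in>observations P. \<forall>a\<in>actions P. \<delta> 0 a ob = \<delta> 0 a ob') \<and>
     (\<forall>s\<in>states P. mu_s \<mu> 0 s = init_belief P s) \<and>
     (\<forall>t\<le>horizon P. \<forall>s\<in>states P. mu_s \<mu> t s = (\<Sum>a\<in>actions P. mu_sa \<mu> t s a)) \<and>
     (\<forall>t\<le>horizon P. \<forall>s\<in>states P. \<forall>a\<in>actions P.
        mu_sa \<mu> t s a = (\<Sum>ob\<in>observations P. mu_soa \<mu> t s ob a)) \<and>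
     (\<forall>t\<le>horizon P. \<forall>s\<in>states P.
        mu_s \<mu> (t + 1) s =
          (\<Sum>s'\<in>states P. \<Sum>a'\<in>actions P. trans_prob P s' a' s * mu_sa \<mu> t s' a')) \<and>
     mccormick P \<mu> \<delta> \<and>
     moments_nonneg P \<mu>"

definition milp_feasible ::
  "('s, 'o, 'a) pomdp \<Rightarrow> ('s, 'o, 'a) moments \<Rightarrow> (nat \<Rightarrow> 'a \<Rightarrow> 'o \<Rightarrow> real) \<Rightarrow> bool" where
  "milp_feasible P \<mu> \<delta> \<longleftrightarrow> linear_constraints P \<mu> \<delta> \<and> \<delta> \<in> det_memoryless_policies P"

definition relaxation_feasible ::
  "('s, 'o, 'a) pomdp \<Rightarrow> ('s, 'o, 'a) moments \<Rightarrow> (nat \<Rightarrow> 'a \<Rightarrow> 'o \<Rightarrow> real) \<Rightarrow> bool" where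
  "relaxation_feasible P \<mu> \<delta> \<longleftrightarrow> linear_constraints P \<mu> \<delta> \<and> \<delta> \<in> memoryless_policies P"

text \<open>
  The common objective of the two programs; it plays no role for feasibility.
\<close>

definition milp_objective :: "('s, 'o, 'a) pomdp \<Rightarrow> ('s, 'o, 'a) moments \<Rightarrow> real" where
  "milp_objective P \<mu> =
     (\<Sum>t\<le>horizon P. \<Sum>s\<in>states P. \<Sum>a\<in>actions P. reward P t s a * mu_sa \<mu> t s a)"

text \<open>
  \<open>cond_prob P s' a' ob s\<close> is $p(s|s',a',o)$; it is $0$ when the denominator vanishes,
  since \<open>x / 0 = 0\<close>.
\<close>

definition cond_prob :: "('s, 'o, 'a) pomdp \<Rightarrow> 's \<Rightarrow> 'a \<Rightarrow> 'o \<Rightarrow> 's \<Rightarrow> real" where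
  "cond_prob P s' a' ob s =
     obs_prob P s ob * trans_prob P s' a' s /
       (\<Sum>u\<in>states P. obs_prob P u ob * trans_prob P s' a' u)"

text \<open>
  \<open>\<nu> t s' a' s ob a\<close> is the additional variable $\mu^t_{s'a'soa}$, for $1 \le t \le T$.
\<close>

definition valid_ineqs ::
  "('s, 'o, 'a) pomdp \<Rightarrow> ('s, 'o, 'a) moments \<Rightarrow>
   (nat \<Rightarrow> 's \<Rightarrow> 'a \<Rightarrow> 's \<Rightarrow> 'o \<Rightarrow> 'a \<Rightarrow> real) \<Rightarrow> bool" where
  "valid_ineqs P \<mu> \<nu> \<longleftrightarrow>
     (\<forall>t\<in>{1..horizon P}.
        (\<forall>s'\<in>states P. \<forall>a'\<in>actions P. \<forall>s\<in>states P. \<forall>ob\<in>observations P. \<forall>a\<in>actions P.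
           \<nu> t s' a' s ob a \<ge> 0) \<and>
        (\<forall>s\<in>states P. \<forall>ob\<in>observations P. \<forall>a\<in>actions P.
           (\<Sum>s'\<in>states P. \<Sum>a'\<in>actions P. \<nu> t s' a' s ob a) = mu_soa \<mu> t s ob a) \<and>
        (\<forall>s'\<in>states P. \<forall>a'\<in>actions P. \<forall>s\<in>states P. \<forall>ob\<in>observations P.
           (\<Sum>a\<in>actions P. \<nu> t s' a' s ob a) =
             obs_prob P s ob * trans_prob P s' a' s * mu_sa \<mu> (t - 1) s' a') \<and>
        (\<forall>s'\<in>states P. \<forall>a'\<in>actions P. \<forall>s\<in>states P. \<forall>ob\<in>observations P. \<forall>a\<in>actions P.
           \<nu> t s' a' s ob a =
             cond_prob P s' a' ob s * (\<Sum>u\<in>states P. \<nu> t s' a' u ob a)))"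

end

theory Submission
  imports Defs
begin

text \<open>
  For a deterministic policy the McCormick inequalities are exact: they force
  $\mu^t_{soa} = \delta^t_{a|o}\,p(o|s)\,\mu^t_s$, so the action at time $t$ is drawn from the
  observation alone.  The additional variable can then be read as the joint law of
  $(S_{t-1},A_{t-1},S_t,O_t,A_t)$, that is
  $\delta^t_{a|o}\,p(o|s)\,p(s|s',a')\,\mu^{t-1}_{s'a'}$.  Summing it over $(s',a')$ and over $a$
  gives (V1) and (V2), and (V3) holds because the factor $\delta^t_{a|o}$ does not depend on $s$:
  given $(S_{t-1},A_{t-1},O_t)$ the action $A_t$ carries no information on $S_t$.

  A fractional policy leaves slack in the McCormick inequalities, and a solution of the relaxation
  can use this slack to let the action depend on the hidden state.  In the counterexample two
  equiprobable states can never be told apart, since there is a single observation and every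
  transition is uniform; (V) therefore requires $\mu^t_{soa}$ not to depend on $s$.  With
  $\delta = 1/2$ the relaxation nevertheless admits the moments in which the action copies the state.
\<close>

text \<open>
  At $\delta = 1$ the two bounds involving $p(o|s)\mu_s$ coincide, and at $\delta = 0$ the
  upper bound $\delta$ meets nonnegativity.
\<close>

lemma mccormick_exact_if_deterministic:
  assumes "milp_feasible P \<mu> \<delta>" "t \<le> horizon P"
    and "s \<in> states P" "ob \<in> observations P" "a \<in> actions P"
  shows "mu_soa \<mu> t s ob a = \<delta> t a ob * (obs_prob P s ob * mu_s \<mu> t s)"
proof -
  have "\<delta> t a ob = 0 \<or> \<delta> t a ob = 1"
    using assms by (auto simp: milp_feasible_def det_memoryless_policies_def)
  moreover have "mu_soa \<mu> t s ob a \<ge> 0"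
    and "mu_soa \<mu> t s ob a \<le> obs_prob P s ob * mu_s \<mu> t s"
    and "mu_soa \<mu> t s ob a \<le> \<delta> t a ob"
    and "mu_soa \<mu> t s ob a \<ge> obs_prob P s ob * mu_s \<mu> t s + \<delta> t a ob - 1"
    using assms
    by (auto simp: milp_feasible_def linear_constraints_def mccormick_def moments_nonneg_def)
  ultimately show ?thesis by auto
qed

text \<open>
  The chain rule for conditional probabilities.  It survives the convention $x/0 = 0$ because a
  vanishing denominator is a vanishing sum of nonnegative joint probabilities.
\<close>

lemma cond_prob_mult_marginal:
  assumes "is_pomdp P" "s' \<in> states P" "a' \<in> actions P" "s \<in> states P" "ob \<in> observations P"
  shows "cond_prob P s' a' ob s * (\<Sum>u\<in>states P. obs_prob P u ob * trans_prob P s' a' u)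
         = obs_prob P s ob * trans_prob P s' a' s"
proof (cases "(\<Sum>u\<in>states P. obs_prob P u ob * trans_prob P s' a' u) = 0")
  case True
  have fin: "finite (states P)"
    and nonneg: "\<And>u. u \<in> states P \<Longrightarrow> obs_prob P u ob * trans_prob P s' a' u \<ge> 0"
    using assms by (auto simp: is_pomdp_def prob_dist_on_def)
  have "obs_prob P s ob * trans_prob P s' a' s = 0"
    using sum_nonneg_0[OF fin nonneg True \<open>s \<in> states P\<close>] .
  with True show ?thesis by simp
next
  case False
  then show ?thesis by (simp add: cond_prob_def)
qed

lemma valid_ineqs_if_milp_feasible:
  assumes pomdp: "is_pomdp P" and feas: "milp_feasible P \<mu> \<delta>"
  shows "valid_ineqs P \<mu>
    (\<lambda>t s' a' s ob a.
       \<delta> t a ob * (obs_prob P s ob * trans_prob P s' a' s * mu_sa \<mu> (t - 1) s' a'))"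
    (is "valid_ineqs P \<mu> ?\<nu>")
  unfolding valid_ineqs_def
proof (intro ballI conjI)
  fix t s' a' s ob a
  assume "t \<in> {1..horizon P}"
    and "s' \<in> states P" "a' \<in> actions P" "s \<in> states P" "ob \<in> observations P" "a \<in> actions P"
  moreover from this have "t \<le> horizon P" "t - 1 \<le> horizon P" by auto
  ultimately show "?\<nu> t s' a' s ob a \<ge> 0"
    using pomdp feas
    by (auto simp: is_pomdp_def prob_dist_on_def milp_feasible_def det_memoryless_policies_def
        memoryless_policies_def linear_constraints_def moments_nonneg_def)
next
  fix t s ob a
  assume t: "t \<in> {1..horizon P}"
    and s: "s \<in> states P" and ob: "ob \<in> observations P" and a: "a \<in> actions P"
  have "\<forall>t\<le>horizon P. \<forall>s\<in>states P. mu_s \<mu> (t + 1) s =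
      (\<Sum>s'\<in>states P. \<Sum>a'\<in>actions P. trans_prob P s' a' s * mu_sa \<mu> t s' a')"
    using feas unfolding milp_feasible_def linear_constraints_def by (elim conjE)
  with s t have dynamics: "mu_s \<mu> t s =
      (\<Sum>s'\<in>states P. \<Sum>a'\<in>actions P. trans_prob P s' a' s * mu_sa \<mu> (t - 1) s' a')"
    by (cases t) auto
  have "(\<Sum>s'\<in>states P. \<Sum>a'\<in>actions P. ?\<nu> t s' a' s ob a)
      = \<delta> t a ob * (obs_prob P s ob * mu_s \<mu> t s)"
    unfolding dynamics by (simp add: sum_distrib_left mult.assoc)
  also have "\<dots> = mu_soa \<mu> t s ob a"
    using mccormick_exact_if_deterministic[OF feas _ s ob a] t by simp
  finally show "(\<Sum>s'\<in>states P. \<Sum>a'\<in>actions P. ?\<nu> t s' a' s ob a) = mu_soa \<mu> t s ob a" .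
next
  fix t s' a' s ob
  assume "t \<in> {1..horizon P}" "ob \<in> observations P"
  then have "(\<Sum>a\<in>actions P. \<delta> t a ob) = 1"
    using feas by (auto simp: milp_feasible_def det_memoryless_policies_def
        memoryless_policies_def prob_dist_on_def)
  then show "(\<Sum>a\<in>actions P. ?\<nu> t s' a' s ob a) =
      obs_prob P s ob * trans_prob P s' a' s * mu_sa \<mu> (t - 1) s' a'"
    by (simp flip: sum_distrib_right)
next
  fix t s' a' s ob a
  assume "s' \<in> states P" "a' \<in> actions P" "s \<in> states P" "ob \<in> observations P"
  \<comment> \<open>In this form the dependence on $s$ is confined to the conditional probability.\<close>
  then have "?\<nu> t s' a' s ob a = \<delta> t a ob * (cond_prob P s' a' ob s *
      (\<Sum>u\<in>states P. obs_prob P u ob * trans_prob P s' a' u) * mu_sa \<mu> (t - 1) s' a')"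
    by (simp add: cond_prob_mult_marginal[OF pomdp])
  also have "\<dots> = cond_prob P s' a' ob s * (\<Sum>u\<in>states P. ?\<nu> t s' a' u ob a)"
    by (simp add: sum_distrib_left sum_distrib_right mult_ac)
  finally show "?\<nu> t s' a' s ob a =
      cond_prob P s' a' ob s * (\<Sum>u\<in>states P. ?\<nu> t s' a' u ob a)" .
qed

text \<open>
  By (V3) the additional variables agree at two states that always have the same conditional
  probability, and (V1) passes this on to $\mu^t_{soa}$.  This is how (V) forbids actions that know
  more about the hidden state than the observation reveals.
\<close>

lemma mu_soa_eq_if_indistinguishable:
  assumes "valid_ineqs P \<mu> \<nu>" "t \<in> {1..horizon P}" "ob \<in> observations P" "a \<in> actions P"
    and "s1 \<in> states P" "s2 \<in> states P"
    and same: "\<And>s' a'. s' \<in> states P \<Longrightarrow> a' \<in> actions P \<Longrightarrow>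
      cond_prob P s' a' ob s1 = cond_prob P s' a' ob s2"
  shows "mu_soa \<mu> t s1 ob a = mu_soa \<mu> t s2 ob a"
proof -
  have V1: "(\<Sum>s'\<in>states P. \<Sum>a'\<in>actions P. \<nu> t s' a' s ob a) = mu_soa \<mu> t s ob a"
    if "s \<in> states P" for s
    using assms(1-4) that unfolding valid_ineqs_def by blast
  have V3: "\<nu> t s' a' s ob a = cond_prob P s' a' ob s * (\<Sum>u\<in>states P. \<nu> t s' a' u ob a)"
    if "s' \<in> states P" "a' \<in> actions P" "s \<in> states P" for s' a' s
    using assms(1-4) that unfolding valid_ineqs_def by blast
  have "\<nu> t s' a' s1 ob a = \<nu> t s' a' s2 ob a" if "s' \<in> states P" "a' \<in> actions P" for s' a'
    using V3[OF that \<open>s1 \<in> states P\<close>] V3[OF that \<open>s2 \<in> states P\<close>] same[OF that] by simp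
  then show ?thesis
    using V1[OF \<open>s1 \<in> states P\<close>] V1[OF \<open>s2 \<in> states P\<close>] by simp
qed

text \<open>
  The horizon is $1$ because (V) is empty at horizon $0$.  The uniform law is stationary, so the
  moments below can be the same at all times.
\<close>

definition uninformative_pomdp :: "(nat, nat, nat) pomdp" where
  "uninformative_pomdp =
     \<lparr>states = {0, 1}, observations = {0}, actions = {0, 1},
      obs_prob = (\<lambda>_ _. 1), trans_prob = (\<lambda>_ _ _. 1/2), reward = (\<lambda>_ _ _. 0),
      horizon = 1, init_belief = (\<lambda>_. 1/2)\<rparr>"

definition state_copying_moments :: "(nat, nat, nat) moments" where
  "state_copying_moments =
     \<lparr>mu_s = (\<lambda>_ _. 1/2), mu_soa = (\<lambda>_ s _ a. if a = s then 1/2 else 0),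
      mu_sa = (\<lambda>_ s a. if a = s then 1/2 else 0)\<rparr>"

lemma is_pomdp_uninformative_pomdp: "is_pomdp uninformative_pomdp"
  by (simp add: uninformative_pomdp_def is_pomdp_def prob_dist_on_def)

text \<open>
  With $\delta = 1/2$ and $p(o|s)\mu_s = 1/2$, the McCormick inequalities say only
  $0 \le \mu_{soa} \le 1/2$.
\<close>

lemma relaxation_feasible_state_copying:
  "relaxation_feasible uninformative_pomdp state_copying_moments (\<lambda>_ _ _. 1/2)"
  by (simp add: uninformative_pomdp_def state_copying_moments_def relaxation_feasible_def
      linear_constraints_def mccormick_def moments_nonneg_def memoryless_policies_def
      prob_dist_on_def)

lemma not_valid_ineqs_state_copying:
  "\<not> valid_ineqs uninformative_pomdp state_copying_moments \<nu>"
proof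
  assume "valid_ineqs uninformative_pomdp state_copying_moments \<nu>"
  then have "mu_soa state_copying_moments 1 0 0 0 = mu_soa state_copying_moments 1 1 0 0"
    by (rule mu_soa_eq_if_indistinguishable) (auto simp: uninformative_pomdp_def cond_prob_def)
  then show False by (simp add: state_copying_moments_def)
qed

theorem proposition3:
  shows "(\<forall>(P :: ('s, 'o, 'a) pomdp) \<mu> \<delta>.
            is_pomdp P \<longrightarrow> milp_feasible P \<mu> \<delta> \<longrightarrow> (\<exists>\<nu>. valid_ineqs P \<mu> \<nu>))
       \<and> (\<exists>(P :: (nat, nat, nat) pomdp) \<mu> \<delta>.
            is_pomdp P \<and> relaxation_feasible P \<mu> \<delta> \<and> \<not> (\<exists>\<nu>. valid_ineqs P \<mu> \<nu>))"
  using valid_ineqs_if_milp_feasible is_pomdp_uninformative_pomdp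
    relaxation_feasible_state_copying not_valid_ineqs_state_copying
  by blast

end
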